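(* Let $N$ be a positive integer and $n\in\mathbb{N}$. In each of the following four cases the set $\mathrm{TFF}(\alpha,N)$ has exactly one maximal element with respect to the majorization order $\preccurlyeq$, namely the sequence $\mathbf L$ given: (1) $\alpha=n$: $\mathbf L=(N,N,\ldots,N)$ ($n$ entries); (2) $\alpha=1+\frac1n$ and $n\mid N$: $\mathbf L=(\frac Nn,\ldots,\frac Nn)$ ($n+1$ entries); (3) $\alpha=n+\frac12$ and $2\mid N$: $\mathbf L=(N,\ldots,N,\frac N2,\frac N2,\frac N2)$ with $n-1$ entries equal to $N$; (4) $\alpha=1+\frac{2}{2n-1}$ and $(2n-1)\mid N$: $\mathbf L=(\frac{2N}{2n-1},\ldots,\frac{2N}{2n-1},\frac{N}{2n-1},\frac{N}{2n-1},\frac{N}{2n-1})$ with $n-1$ entries equal to $\frac{2N}{2n-1}$.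
   Context: $\mathrm{TFF}(\alpha,N)$ is the set of weakly decreasing sequences of positive integers $(L_1,\ldots,L_K)$ such that there exist orthogonal projections $P_1,\ldots,P_K$ on $\mathbb{R}^N$ with $\operatorname{rank}P_i=L_i$ and $\sum_{i=1}^K P_i=\alpha\mathbf I$. Majorization: $\mathbf L\preccurlyeq\mathbf L'$ iff the total sums are equal and $\sum_{i\le k}L_i\le\sum_{i\le k}L'_i$ for all $k\le\min(K,K')$. *)

theory Defs
  imports "HOL-Analysis.Analysis"
begin

text \<open>Orthogonal projection on R^N (N = CARD('n)): symmetric idempotent real matrix.\<close>
definition orth_proj :: "real^'n^'n \<Rightarrow> bool" where
  "orth_proj P \<longleftrightarrow> P ** P = P \<and> transpose P = P"

text \<open>TFF(alpha, N) with N = CARD('n): weakly decreasing lists of positive integers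
  (L_1,...,L_K) realised as ranks of orthogonal projections summing to alpha I.\<close>
definition TFF :: "real \<Rightarrow> 'n::finite itself \<Rightarrow> nat list set" where
  "TFF \<alpha> _ = {L. sorted_wrt (\<ge>) L \<and> (\<forall>x\<in>set L. 0 < x) \<and>
     (\<exists>P :: nat \<Rightarrow> real^'n^'n.
        (\<forall>i<length L. orth_proj (P i) \<and> rank (P i) = L ! i) \<and>
        (\<Sum>i<length L. P i) = \<alpha> *\<^sub>R mat 1)}"

text \<open>Majorization L \<preccurlyeq> L'.\<close>
definition majorized :: "nat list \<Rightarrow> nat list \<Rightarrow> bool" where
  "majorized L L' \<longleftrightarrow> sum_list L = sum_list L' \<and>
     (\<forall>k\<le>min (length L) (length L'). sum_list (take k L) \<le> sum_list (take k L'))"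

definition maximal_elems :: "nat list set \<Rightarrow> nat list set" where
  "maximal_elems S = {L\<in>S. \<forall>L'\<in>S. majorized L L' \<longrightarrow> L' = L}"

end

theory Submission
  imports Defs
begin

(* Taking traces, the ranks of a tight fusion frame with bound alpha on R^N add up to alpha * N.
   If fewer than alpha of its projections are discarded, the rest still span R^N, so the discarded
   ranks add up to at most (alpha - 1) * N; if a set S of more than alpha projections is kept, their
   complements have no common kernel, so the ranks in S add up to at most (|S| - 1) * N.  These
   estimates bound every prefix sum of the rank sequence for alpha = n, 1 + 1/n and n + 1/2.
   The Naimark complement turns a tight fusion frame with bound alpha > 1 into one with bound
   alpha / (alpha - 1), with the same ranks, on a space of dimension (alpha - 1) * N.  It exchanges
   n + 1 with 1 + 1/n and n + 1/2 with 1 + 2/(2n - 1): this transports the bound for n + 1/2 to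
   1 + 2/(2n - 1), and produces the extremal frames from copies of a single projection. *)

definition is_proj :: "'a::euclidean_space set \<Rightarrow> ('a \<Rightarrow> 'a) \<Rightarrow> bool" where
  "is_proj V f \<longleftrightarrow> linear f \<and> (\<forall>x. f (f x) = f x) \<and> (\<forall>x y. f x \<bullet> y = x \<bullet> f y) \<and> range f \<subseteq> V"

text \<open>The tight fusion frames of \<open>V\<close> with bound \<open>\<alpha>\<close>: the projections act on the whole ambient
  space, so a projection onto a subspace of \<open>V\<close> vanishes on the orthogonal complement of \<open>V\<close>.\<close>
definition tight_frame :: "'a::euclidean_space set \<Rightarrow> real \<Rightarrow> 'i set \<Rightarrow> ('i \<Rightarrow> 'a \<Rightarrow> 'a) \<Rightarrow> bool" where
  "tight_frame V \<alpha> I F \<longleftrightarrow> subspace V \<and> finite I \<and> (\<forall>j\<in>I. is_proj V (F j)) \<and>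
     (\<forall>x\<in>V. (\<Sum>j\<in>I. F j x) = \<alpha> *\<^sub>R x)"

definition map_rank :: "('a::euclidean_space \<Rightarrow> 'a) \<Rightarrow> nat" where
  "map_rank f = dim (range f)"

definition orthonormal_basis :: "'a::euclidean_space set \<Rightarrow> 'a set \<Rightarrow> bool" where
  "orthonormal_basis V B \<longleftrightarrow> finite B \<and> pairwise orthogonal B \<and> (\<forall>b\<in>B. norm b = 1) \<and> span B = V"

lemma orthonormal_basis_exists:
  fixes V :: "'a::euclidean_space set"
  assumes "subspace V"
  obtains B where "orthonormal_basis V B" "B \<subseteq> V" "card B = dim V"
  using orthonormal_basis_subspace[OF assms] independent_imp_finite
  unfolding orthonormal_basis_def by metis

lemma orthonormal_basis_inner_self:
  "orthonormal_basis V B \<Longrightarrow> b \<in> B \<Longrightarrow> b \<bullet> b = 1"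
  unfolding orthonormal_basis_def by (simp add: norm_eq_1)

lemma orthonormal_basis_expansion:
  "orthonormal_basis V B \<Longrightarrow> x \<in> V \<Longrightarrow> (\<Sum>b\<in>B. (x \<bullet> b) *\<^sub>R b) = x"
  unfolding orthonormal_basis_def by (metis orthonormal_basis_expand)

lemma orthonormal_basis_parseval:
  assumes "orthonormal_basis V B" "x \<in> V"
  shows "x \<bullet> y = (\<Sum>b\<in>B. (x \<bullet> b) * (b \<bullet> y))"
proof -
  have "x \<bullet> y = (\<Sum>b\<in>B. (x \<bullet> b) *\<^sub>R b) \<bullet> y"
    using orthonormal_basis_expansion[OF assms] by simp
  then show ?thesis by (simp add: inner_sum_left)
qed

lemma is_proj_linear: "is_proj V f \<Longrightarrow> linear f"
  and is_proj_idem: "is_proj V f \<Longrightarrow> f (f x) = f x"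
  and is_proj_adjoint: "is_proj V f \<Longrightarrow> f x \<bullet> y = x \<bullet> f y"
  and is_proj_in: "is_proj V f \<Longrightarrow> f x \<in> V"
  unfolding is_proj_def by auto

lemma is_proj_range_subset: "is_proj V f \<Longrightarrow> range f \<subseteq> V"
  unfolding is_proj_def by auto

lemma is_proj_fixes_range: "is_proj V f \<Longrightarrow> y \<in> range f \<Longrightarrow> f y = y"
  by (auto simp: is_proj_idem)

lemma subspace_range_is_proj: "is_proj V f \<Longrightarrow> subspace (range f)"
  by (simp add: is_proj_linear linear_subspace_image)

lemma is_proj_inner_self: "is_proj V f \<Longrightarrow> f x \<bullet> x = f x \<bullet> f x"
  by (metis is_proj_adjoint is_proj_idem)

lemma is_proj_inner_bounds:
  assumes "is_proj V f"
  shows "0 \<le> f x \<bullet> x" "f x \<bullet> x \<le> x \<bullet> x"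
proof -
  have "0 \<le> (x - f x) \<bullet> (x - f x)" by simp
  then show "f x \<bullet> x \<le> x \<bullet> x"
    using is_proj_inner_self[OF assms, of x]
    by (simp add: inner_diff_left inner_diff_right inner_commute)
  show "0 \<le> f x \<bullet> x" using is_proj_inner_self[OF assms, of x] by simp
qed

lemma is_proj_eq_0_if_orthogonal:
  assumes "is_proj V f" "\<And>y. y \<in> range f \<Longrightarrow> x \<bullet> y = 0"
  shows "f x = 0"
proof -
  have "f x \<bullet> f x = x \<bullet> f (f x)" by (rule is_proj_adjoint[OF assms(1)])
  then show ?thesis using assms(2) by simp
qed

lemma map_rank_le_dim: "is_proj V f \<Longrightarrow> map_rank f \<le> dim V"
  unfolding map_rank_def by (rule dim_subset[OF is_proj_range_subset])

lemma map_rank_eq_dim: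
  assumes "is_proj V f" "\<And>x. x \<in> V \<Longrightarrow> f x = x"
  shows "map_rank f = dim V"
proof -
  have "range f = V" using assms is_proj_range_subset[OF assms(1)] by (metis rangeI subsetI subset_antisym)
  then show ?thesis by (simp add: map_rank_def)
qed

lemma map_rank_eq_0_iff: "linear f \<Longrightarrow> map_rank f = 0 \<longleftrightarrow> (\<forall>x. f x = 0)"
  unfolding map_rank_def using dim_eq_0 by (auto simp: image_subset_iff)

lemma map_rank_eq_trace:
  assumes f: "is_proj V f" and B: "orthonormal_basis V B"
  shows "real (map_rank f) = (\<Sum>b\<in>B. f b \<bullet> b)"
proof -
  obtain C where C: "orthonormal_basis (range f) C" "C \<subseteq> range f" "card C = map_rank f"
    using orthonormal_basis_exists[OF subspace_range_is_proj[OF f]] unfolding map_rank_def .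
  have CV: "C \<subseteq> V" using C(2) is_proj_range_subset[OF f] by blast
  have "f b \<bullet> b = (\<Sum>c\<in>C. (b \<bullet> c) * (c \<bullet> b))" for b
  proof -
    have "f b \<bullet> b = (\<Sum>c\<in>C. (f b \<bullet> c) * (c \<bullet> b))"
      by (rule orthonormal_basis_parseval[OF C(1)]) simp
    also have "\<dots> = (\<Sum>c\<in>C. (b \<bullet> c) * (c \<bullet> b))"
    proof (rule sum.cong)
      fix c assume "c \<in> C"
      then have "f c = c" using C(2) is_proj_fixes_range[OF f] by blast
      then show "(f b \<bullet> c) * (c \<bullet> b) = (b \<bullet> c) * (c \<bullet> b)" by (simp add: is_proj_adjoint[OF f])
    qed simp
    finally show ?thesis .
  qed
  then have "(\<Sum>b\<in>B. f b \<bullet> b) = (\<Sum>c\<in>C. \<Sum>b\<in>B. (c \<bullet> b) * (b \<bullet> c))"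
    by (subst sum.swap) (simp add: mult.commute)
  also have "\<dots> = (\<Sum>c\<in>C. c \<bullet> c)"
    using orthonormal_basis_parseval[OF B, symmetric] CV by (intro sum.cong) auto
  also have "\<dots> = (\<Sum>c\<in>C. 1)"
    using orthonormal_basis_inner_self[OF C(1)] by simp
  finally show ?thesis using C(3) by simp
qed

lemma tight_frame_rank_sum:
  assumes F: "tight_frame V \<alpha> I F"
  shows "(\<Sum>j\<in>I. real (map_rank (F j))) = \<alpha> * real (dim V)"
proof -
  have V: "subspace V" using F by (simp add: tight_frame_def)
  obtain B where B: "orthonormal_basis V B" "B \<subseteq> V" "card B = dim V"
    using orthonormal_basis_exists[OF V] .
  have "(\<Sum>j\<in>I. real (map_rank (F j))) = (\<Sum>j\<in>I. \<Sum>b\<in>B. F j b \<bullet> b)"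
    using F B(1) by (intro sum.cong) (auto simp: tight_frame_def map_rank_eq_trace)
  also have "\<dots> = (\<Sum>b\<in>B. (\<Sum>j\<in>I. F j b) \<bullet> b)"
    by (subst sum.swap) (simp add: inner_sum_left)
  also have "\<dots> = (\<Sum>b\<in>B. \<alpha>)"
    using F B by (intro sum.cong) (auto simp: tight_frame_def orthonormal_basis_inner_self)
  finally show ?thesis using B(3) by simp
qed

lemma dim_UN_le:
  fixes W :: "'i \<Rightarrow> 'a::euclidean_space set"
  assumes "finite I"
  shows "dim (\<Union>j\<in>I. W j) \<le> (\<Sum>j\<in>I. dim (W j))"
proof -
  have "\<forall>j. \<exists>B. independent B \<and> W j \<subseteq> span B \<and> card B = dim (W j)"
    by (meson basis_exists)
  then obtain B where B: "\<And>j. independent (B j)" "\<And>j. W j \<subseteq> span (B j)" "\<And>j. card (B j) = dim (W j)"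
    by metis
  have fin: "finite (\<Union>j\<in>I. B j)" using assms B(1) independent_imp_finite by blast
  have "W j \<subseteq> span (\<Union>j\<in>I. B j)" if "j \<in> I" for j
    using B(2)[of j] span_mono[of "B j" "\<Union>j\<in>I. B j"] that by blast
  then have "dim (\<Union>j\<in>I. W j) \<le> card (\<Union>j\<in>I. B j)" using fin by (intro dim_le_card) auto
  also have "\<dots> \<le> (\<Sum>j\<in>I. card (B j))" using assms by (rule card_UN_le)
  finally show ?thesis using B(3) by simp
qed

lemma dim_le_sum_map_rank:
  fixes V :: "'a::euclidean_space set"
  assumes V: "subspace V" and fin: "finite I" and G: "\<And>j. j \<in> I \<Longrightarrow> is_proj V (G j)"
    and no_kernel: "\<And>x. x \<in> V \<Longrightarrow> (\<And>j. j \<in> I \<Longrightarrow> G j x = 0) \<Longrightarrow> x = 0"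
  shows "dim V \<le> (\<Sum>j\<in>I. map_rank (G j))"
proof -
  let ?U = "\<Union>j\<in>I. range (G j)"
  have "?U \<subseteq> V" using G is_proj_range_subset by blast
  then have UV: "span ?U \<subseteq> V" using V by (rule span_minimal)
  have "span ?U = V"
  proof (rule ccontr)
    assume "span ?U \<noteq> V"
    then have "span ?U \<subset> span V" using UV unfolding span_eq_iff[THEN iffD2, OF V] by blast
    then obtain x where x: "x \<noteq> 0" "x \<in> span V" "\<And>y. y \<in> span ?U \<Longrightarrow> orthogonal x y"
      using orthogonal_to_subspace_exists_gen[of ?U V] by blast
    have "G j x = 0" if "j \<in> I" for j
      using x(3) that by (intro is_proj_eq_0_if_orthogonal[OF G[OF that]])
        (auto simp: orthogonal_def intro: span_base)
    moreover have "x \<in> V" using x(2) span_eq_iff[THEN iffD2, OF V] by simp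
    ultimately show False using no_kernel x(1) by blast
  qed
  then have "dim V = dim ?U" by (metis dim_span)
  also have "\<dots> \<le> (\<Sum>j\<in>I. dim (range (G j)))" using fin by (rule dim_UN_le)
  finally show ?thesis by (simp add: map_rank_def)
qed

lemma tight_frame_rank_sum_le_small:
  assumes F: "tight_frame V \<alpha> I F" and S: "S \<subseteq> I" and card: "real (card S) < \<alpha>"
  shows "(\<Sum>j\<in>S. real (map_rank (F j))) \<le> (\<alpha> - 1) * real (dim V)"
proof -
  have V: "subspace V" and fin: "finite I" and Fp: "\<And>j. j \<in> I \<Longrightarrow> is_proj V (F j)"
    using F by (auto simp: tight_frame_def)
  have "dim V \<le> (\<Sum>j\<in>I-S. map_rank (F j))"
  proof (rule dim_le_sum_map_rank[OF V])
    fix x assume x: "x \<in> V" and zero: "\<And>j. j \<in> I - S \<Longrightarrow> F j x = 0"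
    have "\<alpha> * (x \<bullet> x) = (\<Sum>j\<in>I. F j x \<bullet> x)"
      using F x by (simp add: tight_frame_def flip: inner_sum_left)
    also have "\<dots> = (\<Sum>j\<in>S. F j x \<bullet> x)"
      using zero S fin by (intro sum.mono_neutral_right) auto
    also have "\<dots> \<le> (\<Sum>j\<in>S. x \<bullet> x)"
      using S Fp is_proj_inner_bounds(2) by (intro sum_mono) blast
    finally have "(\<alpha> - real (card S)) * (x \<bullet> x) \<le> 0" by (simp add: algebra_simps)
    then have "x \<bullet> x \<le> 0" using card by (simp add: mult_le_0_iff)
    then show "x = 0" by (metis inner_gt_zero_iff not_le)
  qed (use fin Fp in auto)
  then have "real (dim V) \<le> (\<Sum>j\<in>I-S. real (map_rank (F j)))" by (simp flip: of_nat_sum)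
  moreover have "(\<Sum>j\<in>I. real (map_rank (F j))) = (\<Sum>j\<in>S. real (map_rank (F j))) + (\<Sum>j\<in>I-S. real (map_rank (F j)))"
    using S fin by (metis add.commute sum.subset_diff)
  ultimately show ?thesis using tight_frame_rank_sum[OF F] by (simp add: algebra_simps)
qed

lemma orth_proj_onto_exists:
  fixes V :: "'a::euclidean_space set"
  assumes V: "subspace V"
  obtains p where "is_proj V p" "\<And>x. x \<in> V \<Longrightarrow> p x = x"
proof -
  obtain B where B: "orthonormal_basis V B" "B \<subseteq> V"
    using orthonormal_basis_exists[OF V] by blast
  define p where "p x = (\<Sum>b\<in>B. (x \<bullet> b) *\<^sub>R b)" for x
  have "linear p"
    by (rule linearI) (simp_all add: p_def inner_add_left scaleR_add_left sum.distrib scaleR_sum_right)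
  moreover have "p x \<in> V" for x
    using B V unfolding p_def by (intro subspace_sum subspace_scale) auto
  moreover have "p x \<bullet> y = x \<bullet> p y" for x y
    by (simp add: p_def inner_sum_left inner_sum_right mult.commute inner_commute)
  moreover have "p x = x" if "x \<in> V" for x
    using orthonormal_basis_expansion[OF B(1) that] by (simp add: p_def)
  ultimately show ?thesis using that[of p] by (auto simp: is_proj_def)
qed

lemma is_proj_complement:
  assumes f: "is_proj V f" and p: "is_proj V p" and fix_V: "\<And>x. x \<in> V \<Longrightarrow> p x = x"
    and V: "subspace V"
  shows "is_proj V (\<lambda>x. p x - f x)"
proof -
  have pf: "p (f x) = f x" for x using fix_V is_proj_in[OF f] by blast
  have fp: "f (p x) = f x" for x
  proof -
    have "f (p x) \<bullet> y = f x \<bullet> y" for y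
      by (metis pf is_proj_adjoint[OF f] is_proj_adjoint[OF p])
    then show ?thesis using vector_eq_rdot by blast
  qed
  have "linear (\<lambda>x. p x - f x)"
    using is_proj_linear[OF p] is_proj_linear[OF f] by (rule linear_compose_sub)
  moreover have "p (p x - f x) - f (p x - f x) = p x - f x" for x
    using is_proj_linear[OF p] is_proj_linear[OF f]
    by (simp add: linear_diff is_proj_idem[OF p] is_proj_idem[OF f] pf fp)
  moreover have "(p x - f x) \<bullet> y = x \<bullet> (p y - f y)" for x y
    by (metis inner_diff_left inner_diff_right is_proj_adjoint[OF f] is_proj_adjoint[OF p])
  moreover have "p x - f x \<in> V" for x
    by (simp add: subspace_diff[OF V] is_proj_in[OF f] is_proj_in[OF p])
  ultimately show ?thesis unfolding is_proj_def by blast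
qed

lemma map_rank_complement:
  assumes f: "is_proj V f" and p: "is_proj V p" and fix_V: "\<And>x. x \<in> V \<Longrightarrow> p x = x"
    and V: "subspace V"
  shows "real (map_rank (\<lambda>x. p x - f x)) = real (dim V) - real (map_rank f)"
proof -
  obtain B where B: "orthonormal_basis V B" "B \<subseteq> V" "card B = dim V"
    using orthonormal_basis_exists[OF V] .
  have "real (map_rank (\<lambda>x. p x - f x)) = (\<Sum>b\<in>B. (p b - f b) \<bullet> b)"
    by (rule map_rank_eq_trace[OF is_proj_complement[OF f p fix_V V] B(1)])
  also have "\<dots> = (\<Sum>b\<in>B. 1 - f b \<bullet> b)"
    using B fix_V by (intro sum.cong) (auto simp: inner_diff_left orthonormal_basis_inner_self)
  also have "\<dots> = real (dim V) - real (map_rank f)"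
    using B by (simp add: sum_subtractf map_rank_eq_trace[OF f B(1)])
  finally show ?thesis .
qed

lemma tight_frame_rank_sum_le_large:
  assumes F: "tight_frame V \<alpha> I F" and S: "S \<subseteq> I" and card: "\<alpha> < real (card S)"
  shows "(\<Sum>j\<in>S. real (map_rank (F j))) \<le> (real (card S) - 1) * real (dim V)"
proof -
  have V: "subspace V" and fin: "finite I" and Fp: "\<And>j. j \<in> I \<Longrightarrow> is_proj V (F j)"
    using F by (auto simp: tight_frame_def)
  obtain p where p: "is_proj V p" and fix_V: "\<And>x. x \<in> V \<Longrightarrow> p x = x"
    using orth_proj_onto_exists[OF V] by blast
  have "dim V \<le> (\<Sum>j\<in>S. map_rank (\<lambda>x. p x - F j x))"
  proof (rule dim_le_sum_map_rank[OF V])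
    fix x assume x: "x \<in> V" and zero: "\<And>j. j \<in> S \<Longrightarrow> p x - F j x = 0"
    have "real (card S) * (x \<bullet> x) = (\<Sum>j\<in>S. F j x \<bullet> x)"
      using zero fix_V[OF x] by simp
    also have "\<dots> \<le> (\<Sum>j\<in>I. F j x \<bullet> x)"
      using S fin Fp is_proj_inner_bounds(1) by (intro sum_mono2) blast+
    also have "\<dots> = \<alpha> * (x \<bullet> x)"
      using F x by (simp add: tight_frame_def flip: inner_sum_left)
    finally have "(real (card S) - \<alpha>) * (x \<bullet> x) \<le> 0" by (simp add: algebra_simps)
    then have "x \<bullet> x \<le> 0" using card by (simp add: mult_le_0_iff)
    then show "x = 0" by (metis inner_gt_zero_iff not_le)
  qed (use S fin finite_subset Fp is_proj_complement[OF _ p fix_V V] in auto)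
  then have "real (dim V) \<le> (\<Sum>j\<in>S. real (map_rank (\<lambda>x. p x - F j x)))"
    by (metis of_nat_le_iff of_nat_sum)
  also have "\<dots> = (\<Sum>j\<in>S. real (dim V) - real (map_rank (F j)))"
    using S by (intro sum.cong refl map_rank_complement[OF Fp p fix_V V]) blast
  finally show ?thesis by (simp add: sum_subtractf algebra_simps)
qed

lemma axis_component: "axis k w $ i = (if i = k then w else 0)"
  by (simp add: axis_def)

lemma linear_axis: "linear (axis k :: 'a::real_vector \<Rightarrow> 'a^'k::finite)"
  by (rule linearI) (simp_all add: vec_eq_iff axis_component)

locale naimark =
  fixes V :: "'a::euclidean_space set" and \<alpha> :: real and F :: "'k::finite \<Rightarrow> 'a \<Rightarrow> 'a"
  assumes frame: "tight_frame V \<alpha> UNIV F" and bound_gt_1: "1 < \<alpha>"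
begin

lemma is_proj_F: "is_proj V (F k)"
  using frame by (simp add: tight_frame_def)

lemma F_add [simp]: "F k (x + y) = F k x + F k y"
  and F_scale [simp]: "F k (c *\<^sub>R x) = c *\<^sub>R F k x"
  and F_diff [simp]: "F k (x - y) = F k x - F k y"
  and F_zero [simp]: "F k 0 = 0"
  and F_idem [simp]: "F k (F k x) = F k x"
  using is_proj_linear[OF is_proj_F] is_proj_idem[OF is_proj_F]
  by (simp_all add: linear_add linear_scale linear_diff linear_0)

lemma F_adjoint: "F k x \<bullet> y = x \<bullet> F k y"
  by (rule is_proj_adjoint[OF is_proj_F])

lemma sum_F: "x \<in> V \<Longrightarrow> (\<Sum>k\<in>UNIV. F k x) = \<alpha> *\<^sub>R x"
  using frame by (simp add: tight_frame_def)

text \<open>The analysis operator embeds \<open>V\<close> (isometrically up to the factor \<open>\<surd>\<alpha>\<close>) into the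
  direct sum of the ranges of the \<open>F k\<close>, realised inside \<open>'a^'k\<close>; \<open>diag\<close> projects onto that
  direct sum and \<open>complement\<close> onto the orthogonal complement of the embedded copy of \<open>V\<close>.
  Compressing the coordinate projections \<open>block k\<close> to this complement gives the Naimark
  complement of \<open>F\<close>.\<close>

definition diag :: "'a^'k \<Rightarrow> 'a^'k" where
  "diag Y = (\<chi> k. F k (Y $ k))"

definition synthesis :: "'a^'k \<Rightarrow> 'a" where
  "synthesis Y = (\<Sum>k\<in>UNIV. F k (Y $ k))"

definition analysis :: "'a \<Rightarrow> 'a^'k" where
  "analysis x = (\<chi> k. F k x)"

definition complement :: "'a^'k \<Rightarrow> 'a^'k" where
  "complement Y = diag Y - (1 / \<alpha>) *\<^sub>R analysis (synthesis Y)"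

definition block :: "'k \<Rightarrow> 'a^'k \<Rightarrow> 'a^'k" where
  "block k Y = axis k (F k (Y $ k))"

definition naimark_proj :: "'k \<Rightarrow> 'a^'k \<Rightarrow> 'a^'k" where
  "naimark_proj k Y = (\<alpha> / (\<alpha> - 1)) *\<^sub>R complement (block k (complement Y))"

lemma linear_diag: "linear diag"
  by (rule linearI) (simp_all add: diag_def vec_eq_iff)

lemma linear_synthesis: "linear synthesis"
  by (rule linearI) (simp_all add: synthesis_def sum.distrib scaleR_sum_right)

lemma linear_analysis: "linear analysis"
  by (rule linearI) (simp_all add: analysis_def vec_eq_iff)

lemma linear_complement: "linear complement"
  using linear_diag linear_synthesis linear_analysis
  by (intro linearI) (simp_all add: complement_def linear_add linear_scale algebra_simps)

lemma linear_block: "linear (block k)"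
  by (rule linearI) (simp_all add: block_def vec_eq_iff axis_component)

lemma diag_diag [simp]: "diag (diag Y) = diag Y"
  and synthesis_diag [simp]: "synthesis (diag Y) = synthesis Y"
  and diag_analysis [simp]: "diag (analysis x) = analysis x"
  and diag_block [simp]: "diag (block k Y) = block k Y"
  and synthesis_block [simp]: "synthesis (block k Y) = F k (Y $ k)"
  and block_analysis [simp]: "block k (analysis x) = axis k (F k x)"
  by (simp_all add: diag_def synthesis_def analysis_def block_def vec_eq_iff axis_component
      if_distrib[of "F _"] cong: if_cong)

lemma synthesis_analysis: "x \<in> V \<Longrightarrow> synthesis (analysis x) = \<alpha> *\<^sub>R x"
  by (simp add: synthesis_def analysis_def sum_F)

lemma synthesis_in: "synthesis Y \<in> V"
  unfolding synthesis_def using frame is_proj_in[OF is_proj_F]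
  by (intro subspace_sum) (auto simp: tight_frame_def)

lemma diag_complement [simp]: "diag (complement Y) = complement Y"
  by (simp add: complement_def linear_diff[OF linear_diag] linear_scale[OF linear_diag])

lemma synthesis_complement [simp]: "synthesis (complement Y) = 0"
  using bound_gt_1 by (simp add: complement_def linear_diff[OF linear_synthesis]
      linear_scale[OF linear_synthesis] synthesis_analysis[OF synthesis_in])

lemma complement_diag [simp]: "complement (diag Y) = complement Y"
  by (simp add: complement_def)

lemma complement_complement [simp]: "complement (complement Y) = complement Y"
  by (simp add: complement_def[of "complement Y"] linear_0[OF linear_analysis])

lemma block_complement_block: "block k (complement (block k Y)) = (1 - 1 / \<alpha>) *\<^sub>R block k Y"
  by (simp add: complement_def linear_diff[OF linear_block] linear_scale[OF linear_block])
    (simp add: block_def algebra_simps)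

lemma sum_block: "(\<Sum>k\<in>UNIV. block k Y) = diag Y"
  by (simp add: vec_eq_iff sum_component block_def diag_def axis_component)

lemma analysis_adjoint: "analysis x \<bullet> Y = x \<bullet> synthesis Y"
  by (simp add: analysis_def synthesis_def inner_vec_def inner_sum_right F_adjoint)

lemma inner_analysis: "Y \<bullet> analysis x = synthesis Y \<bullet> x"
  by (metis inner_commute analysis_adjoint)

lemma diag_adjoint: "diag Y \<bullet> Z = Y \<bullet> diag Z"
  by (simp add: diag_def inner_vec_def F_adjoint)

lemma complement_adjoint: "complement Y \<bullet> Z = Y \<bullet> complement Z"
  by (simp add: complement_def inner_diff_left inner_diff_right diag_adjoint analysis_adjoint
      inner_analysis)

lemma block_adjoint: "block k Y \<bullet> Z = Y \<bullet> block k Z"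
  by (simp add: block_def inner_axis inner_axis' F_adjoint)

lemma naimark_factor: "\<alpha> / (\<alpha> - 1) * (1 - 1 / \<alpha>) = 1"
  using bound_gt_1 by (simp add: field_simps)

lemma linear_naimark_proj: "linear (naimark_proj k)"
  unfolding naimark_proj_def
  using linear_compose[OF linear_compose[OF linear_complement linear_block] linear_complement]
  by (simp add: o_def linear_compose_scale_right)

lemma naimark_proj_idem: "naimark_proj k (naimark_proj k Y) = naimark_proj k Y"
proof -
  let ?c = "\<alpha> / (\<alpha> - 1)"
  have "naimark_proj k (naimark_proj k Y)
      = (?c * ?c) *\<^sub>R complement (block k (complement (block k (complement Y))))"
    by (simp add: naimark_proj_def linear_scale[OF linear_complement] linear_scale[OF linear_block])
  also have "\<dots> = (?c * (?c * (1 - 1 / \<alpha>))) *\<^sub>R complement (block k (complement Y))"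
    by (simp add: block_complement_block linear_scale[OF linear_complement])
  also have "\<dots> = naimark_proj k Y"
    by (simp only: naimark_factor mult_1_right naimark_proj_def)
  finally show ?thesis .
qed

lemma is_proj_naimark_proj: "is_proj (range complement) (naimark_proj k)"
proof -
  have "naimark_proj k Y \<bullet> Z = Y \<bullet> naimark_proj k Z" for Y Z
    by (simp add: naimark_proj_def complement_adjoint block_adjoint)
  moreover have "range (naimark_proj k) \<subseteq> range complement"
    by (auto simp: naimark_proj_def simp flip: linear_scale[OF linear_complement])
  ultimately show ?thesis
    unfolding is_proj_def using linear_naimark_proj naimark_proj_idem by blast
qed

lemma sum_naimark_proj:
  assumes "Y \<in> range complement"
  shows "(\<Sum>k\<in>UNIV. naimark_proj k Y) = (\<alpha> / (\<alpha> - 1)) *\<^sub>R Y"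
proof -
  have Y: "complement Y = Y" using assms by auto
  show ?thesis
    by (simp add: naimark_proj_def flip: scaleR_sum_right linear_sum[OF linear_complement])
      (simp add: sum_block Y)
qed

lemma map_rank_naimark_proj: "map_rank (naimark_proj k) = map_rank (F k)"
proof -
  define \<phi> where "\<phi> w = (\<alpha> / (\<alpha> - 1)) *\<^sub>R complement (axis k w)" for w
  have block_axis: "block k (axis k w) = axis k w" if "w \<in> range (F k)" for w
    using that by (auto simp: block_def)
  have block_\<phi>: "block k (\<phi> w) = axis k w" if "w \<in> range (F k)" for w
  proof -
    have "block k (complement (axis k w)) = (1 - 1 / \<alpha>) *\<^sub>R axis k w"
      using block_complement_block[of k "axis k w"] by (simp only: block_axis[OF that])
    then have "block k (\<phi> w) = (\<alpha> / (\<alpha> - 1) * (1 - 1 / \<alpha>)) *\<^sub>R axis k w"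
      by (simp add: \<phi>_def linear_scale[OF linear_block])
    then show ?thesis by (simp only: naimark_factor scaleR_one)
  qed
  have "range (naimark_proj k) \<subseteq> \<phi> ` range (F k)"
    by (auto simp: naimark_proj_def \<phi>_def block_def)
  moreover have "\<phi> w = naimark_proj k (\<phi> w)" if "w \<in> range (F k)" for w
    using block_\<phi>[OF that] by (simp add: naimark_proj_def \<phi>_def linear_scale[OF linear_complement])
  ultimately have "range (naimark_proj k) = \<phi> ` range (F k)" by blast
  moreover have "linear \<phi>"
    unfolding \<phi>_def using linear_compose[OF linear_axis linear_complement]
    by (simp add: o_def linear_compose_scale_right)
  moreover have "inj_on \<phi> (span (range (F k)))"
    using block_\<phi> span_eq_iff[THEN iffD2, OF subspace_range_is_proj[OF is_proj_F]]
    by (metis axis_eq_axis inj_onI)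
  ultimately show ?thesis by (simp add: map_rank_def dim_image_eq)
qed

lemma tight_frame_naimark: "tight_frame (range complement) (\<alpha> / (\<alpha> - 1)) UNIV naimark_proj"
  unfolding tight_frame_def
  using linear_subspace_image[OF linear_complement subspace_UNIV]
  by (simp add: is_proj_naimark_proj sum_naimark_proj)

lemma dim_range_complement: "real (dim (range complement)) = (\<alpha> - 1) * real (dim V)"
proof -
  have "\<alpha> / (\<alpha> - 1) * real (dim (range complement)) = \<alpha> * real (dim V)"
    using tight_frame_rank_sum[OF tight_frame_naimark] tight_frame_rank_sum[OF frame]
    by (simp add: map_rank_naimark_proj)
  moreover have "real (dim (range complement))
      = (\<alpha> - 1) / \<alpha> * (\<alpha> / (\<alpha> - 1) * real (dim (range complement)))"
    using bound_gt_1 by simp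
  ultimately show ?thesis using bound_gt_1 by simp
qed

end

lemma inner_eq_if_norm_preserving:
  assumes f: "linear f" and S: "subspace S" and norm: "\<And>x. x \<in> S \<Longrightarrow> norm (f x) = norm x"
    and x: "x \<in> S" and y: "y \<in> S"
  shows "f x \<bullet> f y = x \<bullet> y"
proof -
  have sq: "f z \<bullet> f z = z \<bullet> z" if "z \<in> S" for z
    using norm[OF that] by (simp add: dot_square_norm)
  have "f (x + y) \<bullet> f (x + y) = (x + y) \<bullet> (x + y)"
    using S x y by (intro sq subspace_add)
  then show ?thesis using sq[OF x] sq[OF y]
    by (simp add: linear_add[OF f] inner_add_left inner_add_right inner_commute)
qed

lemma is_proj_conjugate:
  assumes t: "is_proj K t" and p: "is_proj W p" and fix_W: "\<And>y. y \<in> W \<Longrightarrow> p y = y"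
    and f: "linear f" "f ` K \<subseteq> W" and g: "linear g" "g ` W \<subseteq> K"
    and gf: "\<And>x. x \<in> K \<Longrightarrow> g (f x) = x"
    and adjoint: "\<And>x y. x \<in> K \<Longrightarrow> y \<in> W \<Longrightarrow> f x \<bullet> y = x \<bullet> g y"
  shows "is_proj W (\<lambda>y. f (t (g (p y))))" "map_rank (\<lambda>y. f (t (g (p y)))) = map_rank t"
proof -
  have tK: "t x \<in> K" for x by (rule is_proj_in[OF t])
  have pW: "p y \<in> W" for y by (rule is_proj_in[OF p])
  have fix_f: "p (f (t x)) = f (t x)" for x using fix_W f(2) tK by blast
  have inner: "f (t (g (p y))) \<bullet> z = t (g (p y)) \<bullet> g (p z)" for y z
    by (metis adjoint fix_f is_proj_adjoint[OF p] pW tK)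
  have "linear (\<lambda>y. f (t (g (p y))))"
    using linear_compose[OF linear_compose[OF linear_compose[OF is_proj_linear[OF p] g(1)]
        is_proj_linear[OF t]] f(1)]
    by (simp add: o_def)
  moreover have "f (t (g (p (f (t (g (p y))))))) = f (t (g (p y)))" for y
    using gf[OF tK] by (simp add: fix_f is_proj_idem[OF t])
  moreover have "f (t (g (p y))) \<bullet> z = y \<bullet> f (t (g (p z)))" for y z
    using inner[of y z] inner[of z y] is_proj_adjoint[OF t] by (simp add: inner_commute)
  ultimately show "is_proj W (\<lambda>y. f (t (g (p y))))"
    unfolding is_proj_def using f(2) tK by blast
  have "range (\<lambda>y. f (t (g (p y)))) = f ` range t"
    using gf[OF tK] fix_f is_proj_idem[OF t] by (auto simp: image_iff) metis
  moreover have "inj_on f (span (range t))"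
    using gf is_proj_range_subset[OF t] span_eq_iff[THEN iffD2, OF subspace_range_is_proj[OF t]]
    by (metis inj_on_inverseI subsetD)
  ultimately show "map_rank (\<lambda>y. f (t (g (p y)))) = map_rank t"
    by (simp add: map_rank_def dim_image_eq[OF f(1)])
qed

lemma tight_frame_transport:
  fixes K :: "'a::euclidean_space set" and W :: "'b::euclidean_space set"
  assumes T: "tight_frame K c I T" and W: "subspace W" and d: "dim W = dim K"
  obtains G where "tight_frame W c I G" "\<And>j. j \<in> I \<Longrightarrow> map_rank (G j) = map_rank (T j)"
proof -
  have K: "subspace K" and fin: "finite I" and Tp: "\<And>j. j \<in> I \<Longrightarrow> is_proj K (T j)"
    using T by (auto simp: tight_frame_def)
  obtain f g where f: "linear f" "linear g" "f ` K = W" "g ` W = K"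
      "\<And>x. x \<in> K \<Longrightarrow> norm (f x) = norm x"
      "\<And>x. x \<in> K \<Longrightarrow> g (f x) = x" "\<And>y. y \<in> W \<Longrightarrow> f (g y) = y"
    using isometries_subspaces[OF K W d[symmetric]] by metis
  have adjoint: "f x \<bullet> y = x \<bullet> g y" if "x \<in> K" "y \<in> W" for x y
    using inner_eq_if_norm_preserving[OF f(1) K f(5) that(1), of "g y"] that f(4,7) by auto
  obtain p where p: "is_proj W p" and fix_W: "\<And>y. y \<in> W \<Longrightarrow> p y = y"
    using orth_proj_onto_exists[OF W] by blast
  note conj = is_proj_conjugate[OF Tp p fix_W f(1) _ f(2) _ f(6) adjoint]
  have "(\<Sum>j\<in>I. f (T j (g (p y)))) = c *\<^sub>R y" if y: "y \<in> W" for y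
  proof -
    have "(\<Sum>j\<in>I. T j (g y)) = c *\<^sub>R g y"
      using T f(4) y by (auto simp: tight_frame_def)
    then show ?thesis
      by (simp add: fix_W[OF y] linear_scale[OF f(1)] f(7)[OF y] flip: linear_sum[OF f(1)])
  qed
  then show ?thesis
    using that[of "\<lambda>j y. f (T j (g (p y)))"] conj f(3,4) W fin by (simp add: tight_frame_def)
qed

lemma tight_frame_reindex:
  assumes "inj_on h I" "\<And>i. i \<in> I \<Longrightarrow> G (h i) = F i"
  shows "tight_frame V \<alpha> (h ` I) G \<longleftrightarrow> tight_frame V \<alpha> I F"
  using assms by (simp add: tight_frame_def finite_image_iff sum.reindex cong: sum.cong)

lemma tight_frame_drop_zeros:
  assumes "I \<subseteq> J" "finite J" "\<And>j x. j \<in> J - I \<Longrightarrow> F j x = 0"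
  shows "tight_frame V \<alpha> J F \<longleftrightarrow> tight_frame V \<alpha> I F"
proof -
  have "is_proj V (F j)" if "subspace V" "j \<in> J - I" for j
  proof -
    have "F j = (\<lambda>x. 0)" using assms(3)[OF that(2)] by auto
    then show ?thesis using that(1) by (simp add: is_proj_def linear_zero subspace_0 image_subset_iff)
  qed
  moreover have "(\<Sum>j\<in>J. F j x) = (\<Sum>j\<in>I. F j x)" for x
    using assms by (intro sum.mono_neutral_right) auto
  ultimately show ?thesis
    using assms(1,2) finite_subset by (auto simp: tight_frame_def)
qed

text \<open>The Naimark construction needs a finite index type: the family is padded with zero
  projections to one indexed by \<open>'k\<close>, whose complement again vanishes off the original indices.\<close>
lemma tight_frame_naimark_complement:
  fixes F :: "nat \<Rightarrow> 'a::euclidean_space \<Rightarrow> 'a" and W :: "'b::euclidean_space set"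
  assumes F: "tight_frame V \<alpha> {..<K} F" and gt1: "1 < \<alpha>" and K: "K \<le> CARD('k::finite)"
    and W: "subspace W" and dim_W: "real (dim W) = (\<alpha> - 1) * real (dim V)"
  obtains G where "tight_frame W (\<alpha> / (\<alpha> - 1)) {..<K} G"
    "\<And>j. j < K \<Longrightarrow> map_rank (G j) = map_rank (F j)"
proof -
  obtain \<iota> :: "nat \<Rightarrow> 'k" where \<iota>: "inj_on \<iota> {..<K}"
    using card_le_inj[of "{..<K}" "UNIV :: 'k set"] K by auto
  define F' where "F' k = (if k \<in> \<iota> ` {..<K} then F (the_inv_into {..<K} \<iota> k) else (\<lambda>x. 0))" for k
  have F'_\<iota>: "F' (\<iota> j) = F j" if "j < K" for j
    using that \<iota> by (simp add: F'_def the_inv_into_f_f)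
  have "tight_frame V \<alpha> (\<iota> ` {..<K}) F'"
    using F tight_frame_reindex[OF \<iota>, of F' F] F'_\<iota> by simp
  moreover have "tight_frame V \<alpha> UNIV F' \<longleftrightarrow> tight_frame V \<alpha> (\<iota> ` {..<K}) F'"
    by (rule tight_frame_drop_zeros) (auto simp: F'_def)
  ultimately have "tight_frame V \<alpha> UNIV F'" by blast
  then interpret naimark V \<alpha> F' using gt1 by unfold_locales
  have "dim W = dim (range complement)" using dim_W dim_range_complement by simp
  then obtain G' where G': "tight_frame W (\<alpha> / (\<alpha> - 1)) UNIV G'"
    "\<And>k. map_rank (G' k) = map_rank (F' k)"
    using tight_frame_transport[OF tight_frame_naimark W] map_rank_naimark_proj by (metis UNIV_I)
  have "G' k x = 0" if "k \<notin> \<iota> ` {..<K}" for k x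
  proof -
    have "linear (G' k)" using G'(1) is_proj_linear unfolding tight_frame_def by blast
    moreover have "map_rank (G' k) = 0"
      using G'(2)[of k] that by (simp add: F'_def map_rank_def)
    ultimately show ?thesis by (simp add: map_rank_eq_0_iff)
  qed
  then have "tight_frame W (\<alpha> / (\<alpha> - 1)) UNIV G' \<longleftrightarrow> tight_frame W (\<alpha> / (\<alpha> - 1)) (\<iota> ` {..<K}) G'"
    by (intro tight_frame_drop_zeros) auto
  then have "tight_frame W (\<alpha> / (\<alpha> - 1)) (\<iota> ` {..<K}) G'" using G'(1) by blast
  then have "tight_frame W (\<alpha> / (\<alpha> - 1)) {..<K} (\<lambda>j. G' (\<iota> j))"
    using tight_frame_reindex[OF \<iota>, of G' "\<lambda>j. G' (\<iota> j)"] by simp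
  moreover have "map_rank (G' (\<iota> j)) = map_rank (F j)" if "j < K" for j
    using G'(2) F'_\<iota>[OF that] by simp
  ultimately show ?thesis using that by blast
qed

lemma inner_matrix_vector: "(A *v x) \<bullet> y = x \<bullet> (transpose A *v y)" for A :: "real^'n^'m"
  by (metis dot_lmul_matrix vector_transpose_matrix)

lemma is_proj_UNIV_matrix_iff: "is_proj UNIV ((*v) P) \<longleftrightarrow> orth_proj P" for P :: "real^'n^'n"
proof -
  have "(\<forall>x. P *v (P *v x) = P *v x) \<longleftrightarrow> P ** P = P"
    by (simp add: matrix_eq matrix_vector_mul_assoc)
  moreover have "(\<forall>x y. (P *v x) \<bullet> y = x \<bullet> (P *v y)) \<longleftrightarrow> transpose P = P"
    by (metis inner_matrix_vector matrix_eq vector_eq_ldot)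
  ultimately show ?thesis by (simp add: is_proj_def orth_proj_def)
qed

lemma map_rank_matrix: "map_rank ((*v) P) = rank P" for P :: "real^'n^'n"
  by (simp add: map_rank_def rank_dim_range)

lemma sum_matrix_vector: "(\<Sum>i\<in>I. P i) *v x = (\<Sum>i\<in>I. P i *v x)" for P :: "'i \<Rightarrow> real^'n^'m"
  by (induction I rule: infinite_finite_induct) (auto simp: matrix_vector_mult_add_rdistrib)

lemma TFF_iff:
  "L \<in> TFF \<alpha> TYPE('n::finite) \<longleftrightarrow> sorted_wrt (\<ge>) L \<and> (\<forall>x\<in>set L. 0 < x) \<and>
     (\<exists>F :: nat \<Rightarrow> real^'n \<Rightarrow> real^'n.
        tight_frame UNIV \<alpha> {..<length L} F \<and> (\<forall>i<length L. map_rank (F i) = L ! i))"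
proof -
  have "(\<Sum>i<length L. P i) = \<alpha> *\<^sub>R mat 1 \<longleftrightarrow> (\<forall>x. (\<Sum>i<length L. P i *v x) = \<alpha> *\<^sub>R x)"
    for P :: "nat \<Rightarrow> real^'n^'n"
    by (simp add: matrix_eq sum_matrix_vector flip: scaleR_matrix_vector_assoc)
  then have "(\<exists>P :: nat \<Rightarrow> real^'n^'n. (\<forall>i<length L. orth_proj (P i) \<and> rank (P i) = L ! i) \<and>
        (\<Sum>i<length L. P i) = \<alpha> *\<^sub>R mat 1) \<longleftrightarrow>
      (\<exists>P :: nat \<Rightarrow> real^'n^'n. tight_frame UNIV \<alpha> {..<length L} (\<lambda>i. (*v) (P i)) \<and>
        (\<forall>i<length L. map_rank ((*v) (P i)) = L ! i))"
    by (auto simp: tight_frame_def is_proj_UNIV_matrix_iff map_rank_matrix)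
  also have "\<dots> \<longleftrightarrow> (\<exists>F :: nat \<Rightarrow> real^'n \<Rightarrow> real^'n.
        tight_frame UNIV \<alpha> {..<length L} F \<and> (\<forall>i<length L. map_rank (F i) = L ! i))"
  proof
    assume "\<exists>F :: nat \<Rightarrow> real^'n \<Rightarrow> real^'n.
      tight_frame UNIV \<alpha> {..<length L} F \<and> (\<forall>i<length L. map_rank (F i) = L ! i)"
    then obtain F :: "nat \<Rightarrow> real^'n \<Rightarrow> real^'n"
      where F: "tight_frame UNIV \<alpha> {..<length L} F" "\<forall>i<length L. map_rank (F i) = L ! i" by blast
    have "(*v) (matrix (F i)) = F i" if "i < length L" for i
      using F(1) that matrix_vector_mul(2)[OF is_proj_linear] by (auto simp: tight_frame_def)
    then show "\<exists>P :: nat \<Rightarrow> real^'n^'n. tight_frame UNIV \<alpha> {..<length L} (\<lambda>i. (*v) (P i)) \<and>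
        (\<forall>i<length L. map_rank ((*v) (P i)) = L ! i)"
      using F tight_frame_reindex[where h = id and I = "{..<length L}" and F = F
          and G = "\<lambda>i. (*v) (matrix (F i))"]
      by (intro exI[of _ "\<lambda>i. matrix (F i)"]) auto
  qed auto
  finally show ?thesis unfolding TFF_def by blast
qed

lemma majorized_length_le:
  assumes "majorized A B" "majorized B A" "\<forall>x\<in>set A. 0 < x"
  shows "length A \<le> length B"
proof (rule ccontr)
  assume "\<not> length A \<le> length B"
  then have "min (length B) (length A) = length B" "drop (length B) A \<noteq> []" by auto
  then obtain x xs where x: "drop (length B) A = x # xs" by (meson neq_Nil_conv)
  have "0 < x" using assms(3) x in_set_dropD[of x "length B" A] by simp
  have "sum_list B \<le> sum_list (take (length B) A)"
    using assms(2) \<open>min (length B) (length A) = length B\<close> unfolding majorized_def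
    by (metis take_all order_refl)
  also have "\<dots> < sum_list (take (length B) A) + sum_list (drop (length B) A)"
    using \<open>0 < x\<close> by (simp add: x)
  also have "\<dots> = sum_list A" by (simp flip: sum_list_append)
  finally show False using assms(1) by (simp add: majorized_def)
qed

lemma majorized_antisym:
  assumes AB: "majorized A B" and BA: "majorized B A"
    and pos: "\<forall>x\<in>set A. 0 < x" "\<forall>x\<in>set B. 0 < x"
  shows "A = B"
proof (rule nth_equalityI)
  show len: "length A = length B"
    using majorized_length_le[OF AB BA pos(1)] majorized_length_le[OF BA AB pos(2)] by simp
  have prefix: "sum_list (take k A) = sum_list (take k B)" if "k \<le> length A" for k
    using AB BA that len unfolding majorized_def by (metis le_antisym min.idem)
  fix i assume "i < length A"
  then show "A ! i = B ! i"
    using prefix[of i] prefix[of "Suc i"] len by (simp add: take_Suc_conv_app_nth)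
qed

lemma maximal_elems_eq_singleton:
  assumes "L0 \<in> S" "\<And>L. L \<in> S \<Longrightarrow> majorized L L0" "\<And>L. L \<in> S \<Longrightarrow> \<forall>x\<in>set L. 0 < x"
  shows "maximal_elems S = {L0}"
  using assms majorized_antisym unfolding maximal_elems_def by blast

lemma TFF_obtain_frame:
  assumes "L \<in> TFF \<alpha> TYPE('n::finite)"
  obtains F :: "nat \<Rightarrow> real^'n \<Rightarrow> real^'n"
  where "tight_frame UNIV \<alpha> {..<length L} F" "\<And>i. i < length L \<Longrightarrow> map_rank (F i) = L ! i"
  using assms unfolding TFF_iff by blast

lemma sum_list_TFF: "L \<in> TFF \<alpha> TYPE('n::finite) \<Longrightarrow> real (sum_list L) = \<alpha> * real CARD('n)"
  by (erule TFF_obtain_frame)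
    (use tight_frame_rank_sum in \<open>fastforce simp: sum_list_sum_nth atLeast0LessThan\<close>)

lemma TFF_maximal_elems_eq_singleton:
  assumes L0: "L0 \<in> TFF \<alpha> TYPE('n::finite)"
    and bound: "\<And>K (F :: nat \<Rightarrow> real^'n \<Rightarrow> real^'n) k. tight_frame UNIV \<alpha> {..<K} F \<Longrightarrow>
      (\<And>j. j < K \<Longrightarrow> 0 < map_rank (F j)) \<Longrightarrow> k \<le> K \<Longrightarrow> k \<le> length L0 \<Longrightarrow>
      (\<Sum>j<k. map_rank (F j)) \<le> sum_list (take k L0)"
  shows "maximal_elems (TFF \<alpha> TYPE('n)) = {L0}"
proof (rule maximal_elems_eq_singleton[OF L0])
  fix L assume L: "L \<in> TFF \<alpha> TYPE('n)"
  then show pos: "\<forall>x\<in>set L. 0 < x" by (simp add: TFF_def)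
  obtain F :: "nat \<Rightarrow> real^'n \<Rightarrow> real^'n" where F: "tight_frame UNIV \<alpha> {..<length L} F"
      "\<And>i. i < length L \<Longrightarrow> map_rank (F i) = L ! i"
    using TFF_obtain_frame[OF L] by blast
  have prefix: "sum_list (take k L) = (\<Sum>j<k. map_rank (F j))" if "k \<le> length L" for k
    using that F(2) by (simp add: sum_list_sum_nth min_absorb1 atLeast0LessThan)
  have "0 < map_rank (F j)" if "j < length L" for j using F(2) pos that by simp
  then have "\<forall>k\<le>min (length L) (length L0). sum_list (take k L) \<le> sum_list (take k L0)"
    using bound[OF F(1)] prefix by simp
  moreover have "sum_list L = sum_list L0"
    using sum_list_TFF[OF L] sum_list_TFF[OF L0] by (simp only: of_nat_eq_iff)
  ultimately show "majorized L L0" by (simp add: majorized_def)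
qed

lemma tight_frame_copies:
  assumes "subspace V" "is_proj V p" "\<And>x. x \<in> V \<Longrightarrow> p x = x"
  shows "tight_frame V (real K) {..<K} (\<lambda>_. p)"
  using assms by (simp add: tight_frame_def sum_constant_scaleR)

lemma tight_frame_append:
  fixes F G :: "nat \<Rightarrow> 'a::euclidean_space \<Rightarrow> 'a"
  assumes F: "tight_frame V a {..<K1} F" and G: "tight_frame V b {..<K2} G"
  shows "tight_frame V (a + b) {..<K1 + K2} (\<lambda>j. if j < K1 then F j else G (j - K1))"
proof -
  have "(\<Sum>j<K1 + m. (if j < K1 then F j else G (j - K1)) x) = (\<Sum>j<K1. F j x) + (\<Sum>j<m. G j x)"
    for m x by (induction m) simp_all
  then show ?thesis
    using assms by (auto simp: tight_frame_def scaleR_add_left)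
qed

lemma tight_frame_rank_sum_le_card:
  assumes "tight_frame V \<alpha> I F" "S \<subseteq> I"
  shows "(\<Sum>j\<in>S. real (map_rank (F j))) \<le> real (card S) * real (dim V)"
proof -
  have "(\<Sum>j\<in>S. real (map_rank (F j))) \<le> (\<Sum>j\<in>S. real (dim V))"
    using assms map_rank_le_dim by (intro sum_mono) (auto simp: tight_frame_def)
  then show ?thesis by simp
qed

lemma tight_frame_rank_sum_le_total:
  assumes "tight_frame V \<alpha> I F" "S \<subseteq> I"
  shows "(\<Sum>j\<in>S. real (map_rank (F j))) \<le> \<alpha> * real (dim V)"
  using assms tight_frame_rank_sum[OF assms(1)]
  by (metis (no_types, lifting) of_nat_0_le_iff sum_mono2 tight_frame_def)

lemma tight_frame_prefix_rank_bound:
  assumes F: "tight_frame V (real n + 1 / 2) {..<K} F" and dim: "dim V = 2 * h"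
    and n: "1 \<le> n" and k: "k \<le> K"
  shows "(\<Sum>j<k. map_rank (F j)) \<le> sum_list (take k (replicate (n - 1) (2 * h) @ replicate 3 h))"
proof -
  have S: "{..<k} \<subseteq> {..<K}" using k by auto
  have rn: "real (n - 1) = real n - 1" using n by simp
  have "(\<Sum>j<k. real (map_rank (F j)))
      \<le> real (min k (n - 1)) * (2 * real h) + real (min (k - (n - 1)) 3) * real h"
  proof -
    consider "k \<le> n - 1" | "k = n" | "k = n + 1" | "n + 2 \<le> k" using n by linarith
    then show ?thesis
    proof cases
      case 1
      then show ?thesis using tight_frame_rank_sum_le_card[OF F S] dim by simp
    next
      case 2
      then have "min k (n - 1) = n - 1" "min (k - (n - 1)) 3 = 1" using n by auto
      then show ?thesis
        using tight_frame_rank_sum_le_small[OF F S] 2 dim unfolding rn by (simp add: algebra_simps)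
    next
      case 3
      then have "min k (n - 1) = n - 1" "min (k - (n - 1)) 3 = 2" using n by auto
      then show ?thesis
        using tight_frame_rank_sum_le_large[OF F S] 3 dim unfolding rn by (simp add: algebra_simps)
    next
      case 4
      then have "min k (n - 1) = n - 1" "min (k - (n - 1)) 3 = 3" using n by auto
      then show ?thesis
        using tight_frame_rank_sum_le_total[OF F S] dim n by (simp add: of_nat_diff algebra_simps)
    qed
  qed
  also have "\<dots> = real (sum_list (take k (replicate (n - 1) (2 * h) @ replicate 3 h)))"
    by (simp add: sum_list_replicate)
  finally show ?thesis by (simp only: of_nat_le_iff flip: of_nat_sum)
qed

lemma subspace_of_dim_exists:
  assumes "k \<le> CARD('n::finite)"
  obtains W :: "(real^'n) set" where "subspace W" "dim W = k"
  using choose_subspace_of_subspace[of k "UNIV :: (real^'n) set"] assms by auto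

lemma tight_frame_equal_ranks_exists:
  fixes V :: "(real^'n::finite) set"
  assumes V: "subspace V" and dim_V: "dim V = n * m" and n: "1 \<le> n" and m: "1 \<le> m"
  obtains F where "tight_frame V (1 + 1 / real n) {..<n + 1} F" "\<And>j. j < n + 1 \<Longrightarrow> map_rank (F j) = m"
proof -
  have "n * m \<le> CARD('n)" using dim_V dim_subset_UNIV_cart[of V] by simp
  moreover have "n \<le> n * m" "m \<le> n * m" using n m by simp_all
  ultimately have nm: "n \<le> CARD('n)" "m \<le> CARD('n)" by linarith+
  obtain W :: "(real^'n) set" where W: "subspace W" "dim W = m"
    using subspace_of_dim_exists[OF nm(2)] .
  obtain p where p: "is_proj W p" "\<And>x. x \<in> W \<Longrightarrow> p x = x"
    using orth_proj_onto_exists[OF W(1)] by blast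
  have K: "n + 1 \<le> CARD('n \<times> bool)" using nm(1) n by simp
  have gt_1: "1 < real (n + 1)" using n by simp
  have "real (dim V) = (real (n + 1) - 1) * real (dim W)" using dim_V W(2) by simp
  with tight_frame_naimark_complement[OF tight_frame_copies[OF W(1) p] gt_1 K V]
  obtain G where "tight_frame V (real (n + 1) / (real (n + 1) - 1)) {..<n + 1} G"
      "\<And>j. j < n + 1 \<Longrightarrow> map_rank (G j) = map_rank p"
    by blast
  moreover have "real (n + 1) / (real (n + 1) - 1) = 1 + 1 / real n" using n by (simp add: field_simps)
  ultimately show ?thesis using that map_rank_eq_dim[OF p] W(2) by simp
qed

lemma tight_frame_half_exists:
  fixes V :: "(real^'n::finite) set"
  assumes V: "subspace V" and dim_V: "dim V = 2 * h" and n: "1 \<le> n" and h: "1 \<le> h"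
  obtains F where "tight_frame V (real n + 1 / 2) {..<n + 2} F"
    "\<And>j. j < n + 2 \<Longrightarrow> map_rank (F j) = (replicate (n - 1) (2 * h) @ replicate 3 h) ! j"
proof -
  obtain p where p: "is_proj V p" "\<And>x. x \<in> V \<Longrightarrow> p x = x"
    using orth_proj_onto_exists[OF V] by blast
  obtain G :: "nat \<Rightarrow> real^'n \<Rightarrow> real^'n"
    where G: "tight_frame V (1 + 1 / real 2) {..<2 + 1} G" "\<And>j. j < 2 + 1 \<Longrightarrow> map_rank (G j) = h"
    using tight_frame_equal_ranks_exists[OF V, of 2 h] dim_V h by auto
  define F where "F j = (if j < n - 1 then p else G (j - (n - 1)))" for j
  have "tight_frame V (real (n - 1) + (1 + 1 / real 2)) {..<n - 1 + (2 + 1)} F"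
    unfolding F_def[abs_def] by (rule tight_frame_append[OF tight_frame_copies[OF V p] G(1)])
  moreover have "real (n - 1) + (1 + 1 / real 2) = real n + 1 / 2" "n - 1 + (2 + 1) = n + 2"
    using n by (simp_all add: of_nat_diff)
  ultimately have "tight_frame V (real n + 1 / 2) {..<n + 2} F" by metis
  moreover have "map_rank (F j) = (replicate (n - 1) (2 * h) @ replicate 3 h) ! j" if "j < n + 2" for j
    using that G(2) map_rank_eq_dim[OF p] dim_V n by (auto simp: F_def nth_append)
  ultimately show ?thesis by (rule that)
qed

lemma tight_frame_odd_exists:
  assumes n: "2 \<le> n" and m: "1 \<le> m" and N: "CARD('n::finite) = (2 * n - 1) * m"
  obtains F :: "nat \<Rightarrow> real^'n \<Rightarrow> real^'n"
  where "tight_frame UNIV (1 + 2 / (2 * real n - 1)) {..<n + 2} F"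
    "\<And>j. j < n + 2 \<Longrightarrow> map_rank (F j) = (replicate (n - 1) (2 * m) @ replicate 3 m) ! j"
proof -
  have "2 * m \<le> (2 * n - 1) * m" using n by (intro mult_le_mono1) simp
  then have "2 * m \<le> CARD('n)" using N by simp
  then obtain W :: "(real^'n) set" where W: "subspace W" "dim W = 2 * m"
    by (rule subspace_of_dim_exists)
  obtain F where F: "tight_frame W (real n + 1 / 2) {..<n + 2} F"
      "\<And>j. j < n + 2 \<Longrightarrow> map_rank (F j) = (replicate (n - 1) (2 * m) @ replicate 3 m) ! j"
    using tight_frame_half_exists[OF W _ m, of n] n by auto
  have "n + 2 \<le> 2 * ((2 * n - 1) * 1)" using n by simp
  also have "\<dots> \<le> CARD('n \<times> bool)" using N m by simp
  finally have K: "n + 2 \<le> CARD('n \<times> bool)" .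
  have gt_1: "1 < real n + 1 / 2" using n by simp
  have "real CARD('n) = (2 * real n - 1) * real m" using N n by (simp add: of_nat_diff)
  then have "real (dim (UNIV :: (real^'n) set)) = (real n + 1 / 2 - 1) * real (dim W)"
    using W(2) by (simp add: algebra_simps)
  with tight_frame_naimark_complement[OF F(1) gt_1 K subspace_UNIV]
  obtain G :: "nat \<Rightarrow> real^'n \<Rightarrow> real^'n"
    where "tight_frame UNIV ((real n + 1 / 2) / (real n + 1 / 2 - 1)) {..<n + 2} G"
      "\<And>j. j < n + 2 \<Longrightarrow> map_rank (G j) = map_rank (F j)"
    by blast
  moreover have "(real n + 1 / 2) / (real n + 1 / 2 - 1) = 1 + 2 / (2 * real n - 1)"
    using n by (simp add: field_simps)
  ultimately show ?thesis using that F(2) by simp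
qed

lemma tight_frame_odd_prefix_rank_bound:
  fixes F :: "nat \<Rightarrow> real^'n::finite \<Rightarrow> real^'n"
  assumes n: "2 \<le> n" and N: "CARD('n) = (2 * n - 1) * m"
    and F: "tight_frame UNIV (1 + 2 / (2 * real n - 1)) {..<K} F"
    and pos: "\<And>j. j < K \<Longrightarrow> 0 < map_rank (F j)" and k: "k \<le> K"
  shows "(\<Sum>j<k. map_rank (F j)) \<le> sum_list (take k (replicate (n - 1) (2 * m) @ replicate 3 m))"
proof -
  let ?\<alpha> = "1 + 2 / (2 * real n - 1)"
  have odd_pos: "0 < 2 * real n - 1" using n by simp
  have dim_UNIV: "real (dim (UNIV :: (real^'n) set)) = (2 * real n - 1) * real m"
    using N n by (simp add: of_nat_diff)
  have "real K = (\<Sum>j<K. 1)" by simp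
  also have "\<dots> \<le> (\<Sum>j<K. real (map_rank (F j)))"
    using pos by (intro sum_mono) (simp add: Suc_le_eq)
  also have "\<dots> = ?\<alpha> * ((2 * real n - 1) * real m)"
    using tight_frame_rank_sum[OF F] dim_UNIV by simp
  also have "\<dots> = (2 * real n + 1) * real m"
    using odd_pos by (simp add: field_simps)
  also have "\<dots> \<le> 2 * ((2 * real n - 1) * real m)"
    using mult_right_mono[of 3 "2 * real n" "real m"] n by (simp add: algebra_simps)
  also have "\<dots> = real CARD('n \<times> bool)" using dim_UNIV by simp
  finally have K: "K \<le> CARD('n \<times> bool)" by (simp only: of_nat_le_iff)
  have "2 * m \<le> (2 * n - 1) * m" using n by (intro mult_le_mono1) simp
  then have "2 * m \<le> CARD('n)" using N by simp
  then obtain W :: "(real^'n) set" where W: "subspace W" "dim W = 2 * m"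
    by (rule subspace_of_dim_exists)
  have gt_1: "1 < ?\<alpha>" using odd_pos by simp
  have "real (dim W) = (?\<alpha> - 1) * real (dim (UNIV :: (real^'n) set))"
    using W(2) dim_UNIV odd_pos by simp
  with tight_frame_naimark_complement[OF F gt_1 K W(1)]
  obtain G where G: "tight_frame W (?\<alpha> / (?\<alpha> - 1)) {..<K} G"
      "\<And>j. j < K \<Longrightarrow> map_rank (G j) = map_rank (F j)"
    by blast
  have "?\<alpha> / (?\<alpha> - 1) = real n + 1 / 2" using odd_pos by (simp add: field_simps)
  with G(1) have "tight_frame W (real n + 1 / 2) {..<K} G" by metis
  then have "(\<Sum>j<k. map_rank (G j)) \<le> sum_list (take k (replicate (n - 1) (2 * m) @ replicate 3 m))"
    using tight_frame_prefix_rank_bound[OF _ W(2) _ k] n by simp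
  then show ?thesis using G(2) k by simp
qed

lemma TFF_intro:
  fixes F :: "nat \<Rightarrow> real^'n::finite \<Rightarrow> real^'n"
  assumes "sorted_wrt (\<ge>) L" "\<forall>x\<in>set L. 0 < x" "tight_frame UNIV \<alpha> {..<length L} F"
    "\<And>i. i < length L \<Longrightarrow> map_rank (F i) = L ! i"
  shows "L \<in> TFF \<alpha> TYPE('n)"
  unfolding TFF_iff using assms by blast

lemma sorted_wrt_ge_replicate: "sorted_wrt (\<ge>) (replicate a (x::nat))"
  by (simp add: sorted_wrt_iff_nth_less)

lemma sorted_wrt_ge_replicate_append:
  "y \<le> x \<Longrightarrow> sorted_wrt (\<ge>) (replicate a (x::nat) @ replicate b y)"
  by (auto simp: sorted_wrt_append sorted_wrt_ge_replicate)

lemma maximal_elems_TFF_integer: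
  "maximal_elems (TFF (real n) TYPE('n::finite)) = {replicate n CARD('n)}"
proof (rule TFF_maximal_elems_eq_singleton)
  have id: "is_proj UNIV (\<lambda>x::real^'n. x)" by (simp add: is_proj_def linear_id[unfolded id_def])
  then have "map_rank (\<lambda>x::real^'n. x) = CARD('n)" using map_rank_eq_dim[OF id] by simp
  with tight_frame_copies[OF subspace_UNIV id]
  show "replicate n CARD('n) \<in> TFF (real n) TYPE('n)"
    by (intro TFF_intro) (simp_all add: sorted_wrt_ge_replicate)
next
  fix K k and F :: "nat \<Rightarrow> real^'n \<Rightarrow> real^'n"
  assume F: "tight_frame UNIV (real n) {..<K} F" and "\<And>j. j < K \<Longrightarrow> 0 < map_rank (F j)"
    and k: "k \<le> K" "k \<le> length (replicate n CARD('n))"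
  have "real (\<Sum>j<k. map_rank (F j)) \<le> real (k * CARD('n))"
    using tight_frame_rank_sum_le_card[OF F, of "{..<k}"] k by simp
  moreover have "sum_list (take k (replicate n CARD('n))) = k * CARD('n)"
    using k by (simp add: sum_list_replicate min_absorb1)
  ultimately show "(\<Sum>j<k. map_rank (F j)) \<le> sum_list (take k (replicate n CARD('n)))"
    by (simp only: of_nat_le_iff)
qed

lemma maximal_elems_TFF_one_plus_inverse:
  assumes "n dvd CARD('n::finite)"
  shows "maximal_elems (TFF (1 + 1 / real n) TYPE('n)) = {replicate (n + 1) (CARD('n) div n)}"
proof -
  obtain m where m: "CARD('n) = n * m" using assms by blast
  then have n: "1 \<le> n" and "1 \<le> m" and m_eq: "CARD('n) div n = m"
    using zero_less_card_finite[where 'a = 'n] by (auto simp: Suc_le_eq)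
  show ?thesis unfolding m_eq
  proof (rule TFF_maximal_elems_eq_singleton)
    obtain F :: "nat \<Rightarrow> real^'n \<Rightarrow> real^'n"
      where "tight_frame UNIV (1 + 1 / real n) {..<n + 1} F" "\<And>j. j < n + 1 \<Longrightarrow> map_rank (F j) = m"
      using tight_frame_equal_ranks_exists[OF subspace_UNIV _ n \<open>1 \<le> m\<close>] m by auto
    then show "replicate (n + 1) m \<in> TFF (1 + 1 / real n) TYPE('n)"
      using \<open>1 \<le> m\<close> by (intro TFF_intro) (simp_all add: sorted_wrt_ge_replicate del: replicate.simps(2))
  next
    fix K k and F :: "nat \<Rightarrow> real^'n \<Rightarrow> real^'n"
    assume F: "tight_frame UNIV (1 + 1 / real n) {..<K} F" and "\<And>j. j < K \<Longrightarrow> 0 < map_rank (F j)"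
      and k: "k \<le> K" "k \<le> length (replicate (n + 1) m)"
    have "real (map_rank (F j)) \<le> real m" if "j < K" for j
      using tight_frame_rank_sum_le_small[OF F, of "{j}"] that n m by simp
    then have "(\<Sum>j<k. map_rank (F j)) \<le> (\<Sum>j<k. m)"
      using k by (intro sum_mono) (simp add: of_nat_le_iff)
    moreover have "sum_list (take k (replicate (n + 1) m)) = k * m"
      using k by (simp add: sum_list_replicate min_absorb1 del: replicate.simps(2))
    ultimately show "(\<Sum>j<k. map_rank (F j)) \<le> sum_list (take k (replicate (n + 1) m))"
      by simp
  qed
qed

lemma maximal_elems_TFF_half_integer:
  assumes n: "1 \<le> n" and "2 dvd CARD('n::finite)"
  shows "maximal_elems (TFF (real n + 1 / 2) TYPE('n))
    = {replicate (n - 1) CARD('n) @ replicate 3 (CARD('n) div 2)}"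
proof -
  obtain h where h: "CARD('n) = 2 * h" using assms(2) by blast
  then have "1 \<le> h" and h_eq: "CARD('n) div 2 = h"
    using zero_less_card_finite[where 'a = 'n] by auto
  have dim_UNIV: "dim (UNIV :: (real^'n) set) = 2 * h" using h by simp
  show ?thesis unfolding h_eq unfolding h
  proof (rule TFF_maximal_elems_eq_singleton)
    obtain F :: "nat \<Rightarrow> real^'n \<Rightarrow> real^'n"
      where "tight_frame UNIV (real n + 1 / 2) {..<n + 2} F"
        "\<And>j. j < n + 2 \<Longrightarrow> map_rank (F j) = (replicate (n - 1) (2 * h) @ replicate 3 h) ! j"
      using tight_frame_half_exists[OF subspace_UNIV dim_UNIV n \<open>1 \<le> h\<close>] by blast
    then show "replicate (n - 1) (2 * h) @ replicate 3 h \<in> TFF (real n + 1 / 2) TYPE('n)"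
      using n \<open>1 \<le> h\<close> by (intro TFF_intro) (simp_all add: sorted_wrt_ge_replicate_append)
  next
    fix K k and F :: "nat \<Rightarrow> real^'n \<Rightarrow> real^'n"
    assume "tight_frame UNIV (real n + 1 / 2) {..<K} F" "\<And>j. j < K \<Longrightarrow> 0 < map_rank (F j)"
      "k \<le> K" "k \<le> length (replicate (n - 1) (2 * h) @ replicate 3 h)"
    then show "(\<Sum>j<k. map_rank (F j)) \<le> sum_list (take k (replicate (n - 1) (2 * h) @ replicate 3 h))"
      using tight_frame_prefix_rank_bound[OF _ dim_UNIV n] by blast
  qed
qed

lemma maximal_elems_TFF_one_plus_two_over_odd:
  assumes n: "2 \<le> n" and "(2 * n - 1) dvd CARD('n::finite)"
  shows "maximal_elems (TFF (1 + 2 / (2 * real n - 1)) TYPE('n))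
    = {replicate (n - 1) (2 * CARD('n) div (2 * n - 1)) @ replicate 3 (CARD('n) div (2 * n - 1))}"
proof -
  obtain m where m: "CARD('n) = (2 * n - 1) * m" using assms(2) by blast
  then have "1 \<le> m" "2 * CARD('n) div (2 * n - 1) = 2 * m" "CARD('n) div (2 * n - 1) = m"
    using zero_less_card_finite[where 'a = 'n] n by (auto simp: Suc_le_eq)
  then show ?thesis
  proof (simp only:, intro TFF_maximal_elems_eq_singleton)
    obtain F :: "nat \<Rightarrow> real^'n \<Rightarrow> real^'n"
      where "tight_frame UNIV (1 + 2 / (2 * real n - 1)) {..<n + 2} F"
        "\<And>j. j < n + 2 \<Longrightarrow> map_rank (F j) = (replicate (n - 1) (2 * m) @ replicate 3 m) ! j"
      using tight_frame_odd_exists[OF n \<open>1 \<le> m\<close> m] by blast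
    then show "replicate (n - 1) (2 * m) @ replicate 3 m \<in> TFF (1 + 2 / (2 * real n - 1)) TYPE('n)"
      using n \<open>1 \<le> m\<close> by (intro TFF_intro) (simp_all add: sorted_wrt_ge_replicate_append)
  next
    fix K k and F :: "nat \<Rightarrow> real^'n \<Rightarrow> real^'n"
    assume "tight_frame UNIV (1 + 2 / (2 * real n - 1)) {..<K} F" "\<And>j. j < K \<Longrightarrow> 0 < map_rank (F j)"
      "k \<le> K"
    then show "(\<Sum>j<k. map_rank (F j)) \<le> sum_list (take k (replicate (n - 1) (2 * m) @ replicate 3 m))"
      using tight_frame_odd_prefix_rank_bound[OF n m] by blast
  qed
qed

theorem theorem3p4:
  fixes n :: nat
  defines "N \<equiv> CARD('n::finite)"
  shows "maximal_elems (TFF (real n) TYPE('n)) = {replicate n N}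
    \<and> (n dvd N \<longrightarrow>
         maximal_elems (TFF (1 + 1 / real n) TYPE('n)) = {replicate (n + 1) (N div n)})
    \<and> (1 \<le> n \<and> 2 dvd N \<longrightarrow>
         maximal_elems (TFF (real n + 1 / 2) TYPE('n))
           = {replicate (n - 1) N @ replicate 3 (N div 2)})
    \<and> (1 \<le> n \<and> (2 * n - 1) dvd N \<longrightarrow>
         maximal_elems (TFF (1 + 2 / (2 * real n - 1)) TYPE('n))
           = {replicate (n - 1) (2 * N div (2 * n - 1)) @ replicate 3 (N div (2 * n - 1))})"
proof (intro conjI impI)
  show "maximal_elems (TFF (real n) TYPE('n)) = {replicate n N}"
    unfolding N_def by (rule maximal_elems_TFF_integer)
  show "maximal_elems (TFF (1 + 1 / real n) TYPE('n)) = {replicate (n + 1) (N div n)}"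
    if "n dvd N" using that unfolding N_def by (rule maximal_elems_TFF_one_plus_inverse)
  show "maximal_elems (TFF (real n + 1 / 2) TYPE('n)) = {replicate (n - 1) N @ replicate 3 (N div 2)}"
    if "1 \<le> n \<and> 2 dvd N" using that unfolding N_def by (intro maximal_elems_TFF_half_integer) auto
  show "maximal_elems (TFF (1 + 2 / (2 * real n - 1)) TYPE('n))
      = {replicate (n - 1) (2 * N div (2 * n - 1)) @ replicate 3 (N div (2 * n - 1))}"
    if "1 \<le> n \<and> (2 * n - 1) dvd N"
  proof (cases "n = 1")
    case True
    then show ?thesis using maximal_elems_TFF_integer[of 3] by (simp add: N_def numeral_3_eq_3)
  next
    case False
    then have "2 \<le> n" using that by simp
    then show ?thesis using that unfolding N_def by (intro maximal_elems_TFF_one_plus_two_over_odd) auto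
  qed
qed

end
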